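(* There is an absolute constant $C>0$ such that the following holds. Let $k_1\le k_2$ be positive integers, let $n=k_1+k_2$, and consider an $n$-qubit system divided into a region $A$ of $k_1$ qubits and a region $B$ of $k_2$ qubits. For every pure state $|\psi\rangle$ on the $n$ qubits, with Schmidt rank $r_S$ across the bipartition $A|B$, the binding complexity satisfies $\mathcal{C}_b(|\psi\rangle)\le C\,r_S$. That is, $\mathcal{C}_b(|\psi\rangle)=O(r_S)$.
   Context: The $n$ qubits are divided into two disjoint sets $A$ and $B$ with $k_1$ and $k_2$ qubits. A gate within one set is any unitary acting nontrivially only on the qubits of that set; such gates are free. A straddling gate is a two-qubit gate (any element of $\mathrm{SU}(4)$) acting on one qubit of $A$ and one qubit of $B$. The binding complexity $\mathcal{C}_b(|\psi\rangle)$ is the minimum number of straddling gates in a circuit, composed of straddling gates and free local unitaries and using no ancilla qubits, that maps the all-zero state $|0\rangle^{\otimes n}$ to $|\psi\rangle$. The Schmidt rank $r_S$ is the number of nonzero weights $w_i$ in the Schmidt decomposition $|\psi\rangle=\sum_i w_i|\psi_A^i\rangle\otimes|\psi_B^i\rangle$, where $\{|\psi_A^i\rangle\}$ and $\{|\psi_B^i\rangle\}$ are orthonormal and $\sum_i|w_i|^2=1$. *)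

theory Defs
  imports
    "Jordan_Normal_Form.Schur_Decomposition"
    "HOL-Library.Extended_Nat"
    "HOL-Library.Extended_Real"
begin

text \<open>
  A state of \<open>n\<close> qubits is a complex vector of dimension \<open>2 ^ n\<close>. The computational basis state
  with index \<open>x < 2 ^ n\<close> has qubit \<open>q < n\<close> in state \<open>bit x q\<close>.
  Region \<open>A\<close> consists of the qubits \<open>[0..<k1]\<close>, region \<open>B\<close> of the qubits \<open>[k1..<k1 + k2]\<close>.
\<close>

definition pure_state :: "nat \<Rightarrow> complex vec \<Rightarrow> bool" where
  "pure_state n \<psi> \<longleftrightarrow> \<psi> \<in> carrier_vec (2 ^ n) \<and> \<psi> \<bullet>c \<psi> = 1"

definition zero_state :: "nat \<Rightarrow> complex vec" where
  "zero_state n = unit_vec (2 ^ n) 0"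

definition unitary_mat :: "nat \<Rightarrow> complex mat \<Rightarrow> bool" where
  "unitary_mat d U \<longleftrightarrow>
     U \<in> carrier_mat d d \<and> U * mat_adjoint U = 1\<^sub>m d \<and> mat_adjoint U * U = 1\<^sub>m d"

definition special_unitary_mat :: "nat \<Rightarrow> complex mat \<Rightarrow> bool" where
  "special_unitary_mat d U \<longleftrightarrow> unitary_mat d U \<and> det U = 1"

text \<open>
  The basis index, on the qubits in the list \<open>qs\<close> alone, of the restriction of \<open>x\<close> to \<open>qs\<close>;
  the first qubit of the list is the least significant bit.
\<close>

definition restrict_index :: "nat list \<Rightarrow> nat \<Rightarrow> nat" where
  "restrict_index qs x = horner_sum of_bool 2 (map (bit x) qs)"

text \<open>
  The operator on \<open>n\<close> qubits that applies \<open>G\<close>, of dimension \<open>2 ^ length qs\<close>, to the (distinct)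
  qubits \<open>qs\<close>, and the identity to all other qubits.
\<close>

definition apply_on :: "nat \<Rightarrow> nat list \<Rightarrow> complex mat \<Rightarrow> complex mat" where
  "apply_on n qs G = mat (2 ^ n) (2 ^ n) (\<lambda>(x, y).
     if \<forall>q<n. q \<notin> set qs \<longrightarrow> bit x q = bit y q
     then G $$ (restrict_index qs x, restrict_index qs y) else 0)"

datatype gate =
    Free_A "complex mat"
  | Free_B "complex mat"
  | Straddling nat nat "complex mat"

fun valid_gate :: "nat \<Rightarrow> nat \<Rightarrow> gate \<Rightarrow> bool" where
  "valid_gate k1 k2 (Free_A U) \<longleftrightarrow> unitary_mat (2 ^ k1) U"
| "valid_gate k1 k2 (Free_B U) \<longleftrightarrow> unitary_mat (2 ^ k2) U"
| "valid_gate k1 k2 (Straddling i j U) \<longleftrightarrow>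
     i \<in> {0..<k1} \<and> j \<in> {k1..<k1 + k2} \<and> special_unitary_mat 4 U"

fun gate_mat :: "nat \<Rightarrow> nat \<Rightarrow> gate \<Rightarrow> complex mat" where
  "gate_mat k1 k2 (Free_A U) = apply_on (k1 + k2) [0..<k1] U"
| "gate_mat k1 k2 (Free_B U) = apply_on (k1 + k2) [k1..<k1 + k2] U"
| "gate_mat k1 k2 (Straddling i j U) = apply_on (k1 + k2) [i, j] U"

fun is_straddling :: "gate \<Rightarrow> bool" where
  "is_straddling (Straddling i j U) = True"
| "is_straddling (Free_A U) = False"
| "is_straddling (Free_B U) = False"

text \<open>A circuit is a list of gates, applied from left to right.\<close>

definition run_circuit :: "nat \<Rightarrow> nat \<Rightarrow> gate list \<Rightarrow> complex vec \<Rightarrow> complex vec" where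
  "run_circuit k1 k2 gs \<psi> = fold (\<lambda>g \<phi>. gate_mat k1 k2 g *\<^sub>v \<phi>) gs \<psi>"

definition prepares :: "nat \<Rightarrow> nat \<Rightarrow> gate list \<Rightarrow> complex vec \<Rightarrow> bool" where
  "prepares k1 k2 gs \<psi> \<longleftrightarrow>
     (\<forall>g \<in> set gs. valid_gate k1 k2 g) \<and> run_circuit k1 k2 gs (zero_state (k1 + k2)) = \<psi>"

text \<open>
  The infimum is taken in \<^typ>\<open>enat\<close>, so that it would be \<open>\<infinity>\<close>, rather than \<open>0\<close>, if no
  circuit prepared the state.
\<close>

definition binding_complexity :: "nat \<Rightarrow> nat \<Rightarrow> complex vec \<Rightarrow> enat" where
  "binding_complexity k1 k2 \<psi> =
     (INF gs \<in> {gs. prepares k1 k2 gs \<psi>}. enat (length (filter is_straddling gs)))"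

definition tensor_AB :: "nat \<Rightarrow> nat \<Rightarrow> complex vec \<Rightarrow> complex vec \<Rightarrow> complex vec" where
  "tensor_AB k1 k2 u v = vec (2 ^ (k1 + k2)) (\<lambda>x.
     u $ restrict_index [0..<k1] x * v $ restrict_index [k1..<k1 + k2] x)"

definition orthonormal_family :: "nat \<Rightarrow> nat \<Rightarrow> (nat \<Rightarrow> complex vec) \<Rightarrow> bool" where
  "orthonormal_family d m u \<longleftrightarrow>
     (\<forall>i<m. u i \<in> carrier_vec d) \<and>
     (\<forall>i<m. \<forall>j<m. u i \<bullet>c u j = (if i = j then 1 else 0))"

definition schmidt_decomposition ::
  "nat \<Rightarrow> nat \<Rightarrow> complex vec \<Rightarrow> nat \<Rightarrow> (nat \<Rightarrow> complex)
     \<Rightarrow> (nat \<Rightarrow> complex vec) \<Rightarrow> (nat \<Rightarrow> complex vec) \<Rightarrow> bool" where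
  "schmidt_decomposition k1 k2 \<psi> m w a b \<longleftrightarrow>
     orthonormal_family (2 ^ k1) m a \<and>
     orthonormal_family (2 ^ k2) m b \<and>
     (\<Sum>i<m. (cmod (w i))\<^sup>2) = 1 \<and>
     \<psi> = vec (2 ^ (k1 + k2)) (\<lambda>x. \<Sum>i<m. w i * tensor_AB k1 k2 (a i) (b i) $ x)"

text \<open>
  Every pure state has a Schmidt decomposition, and the number of its nonzero weights is the same
  for all decompositions of a state.
\<close>

definition schmidt_rank :: "nat \<Rightarrow> nat \<Rightarrow> complex vec \<Rightarrow> nat" where
  "schmidt_rank k1 k2 \<psi> =
     (THE r. \<exists>m w a b. schmidt_decomposition k1 k2 \<psi> m w a b \<and> r = card {i. i < m \<and> w i \<noteq> 0})"

end

theory Submission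
  imports Defs "Jordan_Normal_Form.Spectral_Radius"
begin

text \<open>
  Write \<open>\<psi> = \<Sum>\<^sub>i w\<^sub>i a\<^sub>i \<otimes> b\<^sub>i\<close> with \<open>r\<close> nonzero weights, and let \<open>t \<le> k1\<close> be such that
  \<open>r \<le> 2\<^sup>t\<close>. A free unitary on \<open>A\<close> takes \<open>|0\<rangle>\<close> to \<open>\<Sum>\<^sub>i w\<^sub>i |i\<rangle>\<close>. Since \<open>i < 2\<^sup>t\<close>, copying the lowest
  \<open>t\<close> bits of \<open>i\<close> to \<open>B\<close>, with one controlled-NOT each, produces \<open>\<Sum>\<^sub>i w\<^sub>i |i\<rangle> \<otimes> |i\<rangle>\<close>, and free
  unitaries rotate \<open>|i\<rangle>\<close> into \<open>a\<^sub>i\<close> and into \<open>b\<^sub>i\<close>. So \<open>\<lceil>log\<^sub>2 r\<rceil>\<close> straddling gates suffice; the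
  cruder choice \<open>t = min r k1\<close> gives the theorem with \<open>C = 1\<close>.
\<close>

section \<open>Orthonormal families\<close>

text \<open>Families are plain functions over an arbitrary index set, so that restricting the index
  set or replacing a member involves no carrier conditions; only arguments below \<open>d\<close>
  count.\<close>

definition orthonormal_on :: "nat \<Rightarrow> 'i set \<Rightarrow> ('i \<Rightarrow> nat \<Rightarrow> complex) \<Rightarrow> bool" where
  "orthonormal_on d I u \<longleftrightarrow>
     (\<forall>i\<in>I. \<forall>j\<in>I. (\<Sum>x<d. u i x * cnj (u j x)) = (if i = j then 1 else 0))"

lemma orthonormal_onD:
  "orthonormal_on d I u \<Longrightarrow> i \<in> I \<Longrightarrow> j \<in> I \<Longrightarrow>
     (\<Sum>x<d. u i x * cnj (u j x)) = (if i = j then 1 else 0)"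
  by (auto simp: orthonormal_on_def)

lemma orthonormal_on_subset:
  "orthonormal_on d I u \<Longrightarrow> J \<subseteq> I \<Longrightarrow> orthonormal_on d J u"
  unfolding orthonormal_on_def by blast

lemma orthonormal_on_cong:
  assumes "\<And>i x. i \<in> I \<Longrightarrow> x < d \<Longrightarrow> u i x = v i x"
  shows "orthonormal_on d I u \<longleftrightarrow> orthonormal_on d I v"
  using assms by (auto simp: orthonormal_on_def)

lemma orthonormal_on_cnj:
  assumes "orthonormal_on d I u"
  shows "orthonormal_on d I (\<lambda>i x. cnj (u i x))"
  unfolding orthonormal_on_def
proof (intro ballI)
  fix i j assume "i \<in> I" "j \<in> I"
  have "(\<Sum>x<d. cnj (u i x) * cnj (cnj (u j x))) = cnj (\<Sum>x<d. u i x * cnj (u j x))"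
    by simp
  also have "\<dots> = (if i = j then 1 else 0)"
    using orthonormal_onD[OF assms \<open>i \<in> I\<close> \<open>j \<in> I\<close>] by simp
  finally show "(\<Sum>x<d. cnj (u i x) * cnj (cnj (u j x))) = (if i = j then 1 else 0)" .
qed

lemma orthonormal_on_reindex:
  assumes "orthonormal_on d I u" "inj_on e J" "e ` J \<subseteq> I"
  shows "orthonormal_on d J (\<lambda>i. u (e i))"
  using assms unfolding orthonormal_on_def inj_on_def by (auto simp: image_subset_iff)

section \<open>Coordinates of vectors, linear systems and eigenvectors\<close>

lemma cinner_conv_sum:
  assumes "u \<in> carrier_vec d" "v \<in> carrier_vec d"
  shows "u \<bullet>c v = (\<Sum>x<d. u $ x * cnj (v $ x))"
  using assms by (auto simp: scalar_prod_def atLeast0LessThan intro!: sum.cong)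

lemma orthonormal_family_iff:
  "orthonormal_family d m u \<longleftrightarrow>
     (\<forall>i<m. u i \<in> carrier_vec d) \<and> orthonormal_on d {..<m} (\<lambda>i x. u i $ x)"
proof (cases "\<forall>i<m. u i \<in> carrier_vec d")
  case True
  then have "u i \<bullet>c u j = (\<Sum>x<d. u i $ x * cnj (u j $ x))" if "i < m" "j < m" for i j
    using that by (simp add: cinner_conv_sum)
  with True show ?thesis
    by (simp add: orthonormal_family_def orthonormal_on_def Ball_def)
qed (auto simp: orthonormal_family_def)

lemma mult_mat_vec_conv_sum:
  "i < n \<Longrightarrow> (mat n m A *\<^sub>v vec m v) $ i = (\<Sum>x<m. A (i, x) * v x)"
  by (auto simp: scalar_prod_def atLeast0LessThan intro!: sum.cong)

lemma vec_eq_vec_index: "v \<in> carrier_vec n \<Longrightarrow> v = vec n (\<lambda>i. v $ i)"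
  by auto

text \<open>Padding the \<open>m\<close> equations with zero rows gives a square matrix whose last
  row vanishes, because \<open>m < d\<close>; its determinant is 0 and its kernel
  nontrivial.\<close>

lemma homogeneous_system_nontrivial_solution:
  fixes A :: "nat \<Rightarrow> nat \<Rightarrow> complex"
  assumes "m < d"
  shows "\<exists>v. (\<exists>x<d. v x \<noteq> 0) \<and> (\<forall>i<m. (\<Sum>x<d. A i x * v x) = 0)"
proof -
  define M where "M = mat d d (\<lambda>(i, x). if i < m then A i x else 0)"
  have M: "M \<in> carrier_mat d d" by (simp add: M_def)
  have "M = mat\<^sub>r d d (\<lambda>i. if i = d - 1 then 0\<^sub>v d else row M i)"
    using assms by (intro eq_matI) (auto simp: M_def)
  moreover have "det (mat\<^sub>r d d (\<lambda>i. if i = d - 1 then 0\<^sub>v d else row M i)) = 0"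
    using assms M by (intro det_row_0) auto
  ultimately have "det M = 0" by simp
  then obtain v where v: "v \<in> carrier_vec d" "v \<noteq> 0\<^sub>v d" "M *\<^sub>v v = 0\<^sub>v d"
    using det_0_iff_vec_prod_zero[OF M] by blast
  have "\<exists>x<d. v $ x \<noteq> 0"
    using v(1,2) by (metis carrier_vecD eq_vecI index_zero_vec)
  moreover have "(\<Sum>x<d. A i x * v $ x) = 0" if "i < m" for i
  proof -
    have "(M *\<^sub>v v) $ i = (\<Sum>x<d. (if i < m then A i x else 0) * v $ x)"
      using that assms by (subst vec_eq_vec_index[OF v(1)]) (simp only: M_def, subst mult_mat_vec_conv_sum, auto)
    then show ?thesis using that assms v(3) by simp
  qed
  ultimately show ?thesis by blast
qed

text \<open>The characteristic polynomial has a root over the complex numbers; \<open>0 < d\<close>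
  excludes the empty matrix, for which this polynomial is constant.\<close>

lemma complex_matrix_has_eigenvector:
  fixes A :: "nat \<Rightarrow> nat \<Rightarrow> complex"
  assumes "0 < d"
  obtains c v where "\<exists>x<d. v x \<noteq> 0" "\<And>i. i < d \<Longrightarrow> (\<Sum>x<d. A i x * v x) = c * v i"
proof -
  define M where "M = mat d d (\<lambda>(i, x). A i x)"
  have M: "M \<in> carrier_mat d d" by (simp add: M_def)
  obtain c v where v: "v \<in> carrier_vec d" "v \<noteq> 0\<^sub>v d" "M *\<^sub>v v = c \<cdot>\<^sub>v v"
    using spectrum_non_empty[OF M assms] M by (auto simp: spectrum_def eigenvalue_def eigenvector_def)
  have "\<exists>x<d. v $ x \<noteq> 0"
    using v(1,2) by (metis carrier_vecD eq_vecI index_zero_vec)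
  moreover have "(\<Sum>x<d. A i x * v $ x) = c * v $ i" if "i < d" for i
  proof -
    have "(M *\<^sub>v v) $ i = (\<Sum>x<d. A i x * v $ x)"
      using that by (subst vec_eq_vec_index[OF v(1)]) (simp only: M_def, subst mult_mat_vec_conv_sum, auto)
    then show ?thesis using that v(1,3) by simp
  qed
  ultimately show thesis by (rule that)
qed

section \<open>Norms and the completion of orthonormal families\<close>

lemma sum_mult_cnj_eq_sum_norm:
  "(\<Sum>x\<in>X. f x * cnj (f x)) = complex_of_real (\<Sum>x\<in>X. (cmod (f x))\<^sup>2)"
  by (simp only: of_real_sum complex_norm_square)

lemma normalize_nonzero:
  fixes v :: "nat \<Rightarrow> complex"
  assumes "\<exists>x<d. v x \<noteq> 0"
  shows "\<exists>c::complex. c \<noteq> 0 \<and> (\<Sum>x<d. (c * v x) * cnj (c * v x)) = 1"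
proof -
  define s where "s = (\<Sum>x<d. (cmod (v x))\<^sup>2)"
  from assms obtain y where "y < d" "v y \<noteq> 0" by blast
  then have "s > 0" unfolding s_def by (intro sum_pos2[of _ y]) auto
  define c where "c = complex_of_real (1 / sqrt s)"
  have "(\<Sum>x<d. (c * v x) * cnj (c * v x)) = complex_of_real (\<Sum>x<d. (cmod (c * v x))\<^sup>2)"
    by (rule sum_mult_cnj_eq_sum_norm)
  also have "(\<Sum>x<d. (cmod (c * v x))\<^sup>2) = (cmod c)\<^sup>2 * s"
    by (simp add: s_def norm_mult power_mult_distrib sum_distrib_left)
  also have "\<dots> = 1" using \<open>s > 0\<close> by (simp add: c_def norm_divide power_divide)
  finally show ?thesis using \<open>s > 0\<close> by (intro exI[of _ c]) (auto simp: c_def)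
qed

text \<open>Orthogonality is assumed with the conjugate on \<open>u i\<close>: this is a homogeneous
  linear system in the new vector \<open>v\<close>, the form in which such vectors are
  found.\<close>

lemma orthonormal_on_insert:
  assumes u: "orthonormal_on d {..<m} u"
    and ortho: "\<And>i. i < m \<Longrightarrow> (\<Sum>x<d. cnj (u i x) * v x) = 0"
    and norm: "(\<Sum>x<d. v x * cnj (v x)) = 1"
  shows "orthonormal_on d {..<Suc m} (u(m := v))"
proof -
  have "(\<Sum>x<d. u i x * cnj (v x)) = 0" if "i < m" for i
  proof -
    have "(\<Sum>x<d. u i x * cnj (v x)) = cnj (\<Sum>x<d. cnj (u i x) * v x)" by simp
    then show ?thesis using ortho[OF that] by simp
  qed
  moreover have "(\<Sum>x<d. v x * cnj (u i x)) = 0" if "i < m" for i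
    using ortho[OF that] by (simp add: mult.commute)
  ultimately show ?thesis
    using norm u unfolding orthonormal_on_def by (auto simp: less_Suc_eq)
qed

text \<open>As long as \<open>m < d\<close>, the \<open>m\<close> orthogonality conditions have a
  nonzero solution, which after normalisation becomes the next member. The induction runs downwards
  from \<open>m = d\<close>, with \<open>u\<close> generalised.\<close>

lemma orthonormal_on_extend:
  assumes "orthonormal_on d {..<m} u" "m \<le> d"
  shows "\<exists>u'. orthonormal_on d {..<d} u' \<and> (\<forall>i<m. u' i = u i)"
  using assms(2,1)
proof (induction m arbitrary: u rule: inc_induct)
  case base
  then show ?case by blast
next
  case (step m)
  obtain v where v: "\<exists>x<d. v x \<noteq> 0" "\<And>i. i < m \<Longrightarrow> (\<Sum>x<d. cnj (u i x) * v x) = 0"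
    using homogeneous_system_nontrivial_solution[OF step.hyps(2), of "\<lambda>i x. cnj (u i x)"] by blast
  obtain c where c: "(\<Sum>x<d. (c * v x) * cnj (c * v x)) = 1"
    using normalize_nonzero[OF v(1)] by blast
  have "(\<Sum>x<d. cnj (u i x) * (c * v x)) = 0" if "i < m" for i
  proof -
    have "(\<Sum>x<d. cnj (u i x) * (c * v x)) = c * (\<Sum>x<d. cnj (u i x) * v x)"
      by (simp add: sum_distrib_left mult.left_commute)
    then show ?thesis using v(2)[OF that] by simp
  qed
  from step.IH[OF orthonormal_on_insert[OF step.prems this c]] obtain u' where
    "orthonormal_on d {..<d} u'" "\<forall>i<Suc m. u' i = (u(m := \<lambda>x. c * v x)) i" by blast
  then show ?case by (intro exI[of _ u']) auto
qed

section \<open>Unitary matrices, basis expansions and dimension bounds\<close>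

lemma mat_adjoint_index:
  assumes "(A :: complex mat) \<in> carrier_mat d d" "i < d" "j < d"
  shows "mat_adjoint A $$ (i, j) = cnj (A $$ (j, i))"
  using assms by (auto simp: mat_adjoint_def mat_of_rows_index cols_def)

lemma mat_adjoint_carrier [simp]:
  "(A :: complex mat) \<in> carrier_mat d d \<Longrightarrow> mat_adjoint A \<in> carrier_mat d d"
  by (auto simp: mat_adjoint_def)

text \<open>Orthonormality of the columns says that the adjoint is a left inverse; for square
  matrices it is then also a right inverse.\<close>

lemma orthonormal_on_imp_unitary_mat:
  assumes "orthonormal_on d {..<d} u"
  shows "unitary_mat d (mat d d (\<lambda>(x, i). u i x))"
proof -
  define U where "U = mat d d (\<lambda>(x, i). u i x)"
  have U: "U \<in> carrier_mat d d" by (simp add: U_def)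
  have "mat_adjoint U * U = 1\<^sub>m d"
  proof (rule eq_matI)
    fix i j assume "i < dim_row (1\<^sub>m d :: complex mat)" "j < dim_col (1\<^sub>m d :: complex mat)"
    then have ij: "i < d" "j < d" by auto
    have "(mat_adjoint U * U) $$ (i, j) = (\<Sum>x<d. mat_adjoint U $$ (i, x) * U $$ (x, j))"
      using ij U mat_adjoint_carrier[OF U]
      by (auto simp: scalar_prod_def atLeast0LessThan simp del: mat_adjoint_carrier intro!: sum.cong)
    also have "\<dots> = (\<Sum>x<d. u j x * cnj (u i x))"
      using ij by (simp add: mat_adjoint_index[OF U]) (simp add: U_def mult.commute)
    also have "\<dots> = 1\<^sub>m d $$ (i, j)"
      using ij orthonormal_onD[OF assms, of j i] by auto
    finally show "(mat_adjoint U * U) $$ (i, j) = 1\<^sub>m d $$ (i, j)" .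
  qed (use U carrier_matD[OF mat_adjoint_carrier[OF U]] in auto)
  then show ?thesis
    using U mat_mult_left_right_inverse[OF mat_adjoint_carrier[OF U] U]
    by (simp add: unitary_mat_def U_def)
qed

text \<open>The resolution of the identity: \<open>U * mat_adjoint U\<close> is the identity matrix,
  read entrywise.\<close>

lemma orthonormal_on_complete:
  assumes "orthonormal_on d {..<d} u" "x < d" "y < d"
  shows "(\<Sum>i<d. u i x * cnj (u i y)) = (if x = y then 1 else 0)"
proof -
  define U where "U = mat d d (\<lambda>(x, i). u i x)"
  have U: "U \<in> carrier_mat d d" by (simp add: U_def)
  have "(\<Sum>i<d. u i x * cnj (u i y)) = (\<Sum>i<d. U $$ (x, i) * mat_adjoint U $$ (i, y))"
    using assms by (simp add: mat_adjoint_index[OF U]) (simp add: U_def)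
  also have "\<dots> = (U * mat_adjoint U) $$ (x, y)"
    using assms(2,3) U mat_adjoint_carrier[OF U]
    by (auto simp: scalar_prod_def atLeast0LessThan simp del: mat_adjoint_carrier intro!: sum.cong)
  also have "\<dots> = 1\<^sub>m d $$ (x, y)"
    using orthonormal_on_imp_unitary_mat[OF assms(1)] by (simp add: unitary_mat_def U_def)
  finally show ?thesis using assms(2,3) by simp
qed

lemma orthonormal_on_expansion:
  assumes "orthonormal_on d {..<d} u" "x < d"
  shows "f x = (\<Sum>i<d. (\<Sum>y<d. f y * cnj (u i y)) * u i x)"
proof -
  have "(\<Sum>i<d. (\<Sum>y<d. f y * cnj (u i y)) * u i x) = (\<Sum>i<d. \<Sum>y<d. f y * (u i x * cnj (u i y)))"
    by (simp add: sum_distrib_left sum_distrib_right mult_ac)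
  also have "\<dots> = (\<Sum>y<d. \<Sum>i<d. f y * (u i x * cnj (u i y)))"
    by (rule sum.swap)
  also have "\<dots> = (\<Sum>y<d. f y * (if x = y then 1 else 0))"
    using assms by (intro sum.cong refl) (simp add: orthonormal_on_complete flip: sum_distrib_left)
  also have "\<dots> = f x" using assms(2) by (simp add: if_distrib cong: if_cong)
  finally show ?thesis by simp
qed

text \<open>Pythagoras: expanding the square yields a double sum over \<open>I\<close> in which
  orthonormality kills the cross terms. The index set is arbitrary so as to cover both full bases
  and Schmidt sums.\<close>

lemma sum_norm_square_combination:
  assumes "orthonormal_on d I u" "finite I"
    and "\<And>x. x < d \<Longrightarrow> f x = (\<Sum>i\<in>I. c i * u i x)"
  shows "(\<Sum>x<d. (cmod (f x))\<^sup>2) = (\<Sum>i\<in>I. (cmod (c i))\<^sup>2)"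
proof -
  have "(\<Sum>x<d. f x * cnj (f x)) =
      (\<Sum>x<d. \<Sum>i\<in>I. \<Sum>j\<in>I. c i * cnj (c j) * (u i x * cnj (u j x)))"
    using assms(3) by (intro sum.cong refl) (simp add: sum_product mult_ac)
  also have "\<dots> = (\<Sum>i\<in>I. \<Sum>j\<in>I. \<Sum>x<d. c i * cnj (c j) * (u i x * cnj (u j x)))"
    by (simp add: sum.swap[of _ _ "{..<d}"])
  also have "\<dots> = (\<Sum>i\<in>I. \<Sum>j\<in>I. c i * cnj (c j) * (if i = j then 1 else 0))"
    using orthonormal_onD[OF assms(1)] by (intro sum.cong refl) (simp flip: sum_distrib_left)
  also have "\<dots> = (\<Sum>i\<in>I. c i * cnj (c i))"
    using assms(2) by (intro sum.cong refl) (simp add: if_distrib cong: if_cong)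
  finally show ?thesis
    unfolding sum_mult_cnj_eq_sum_norm by (simp only: of_real_eq_iff)
qed

lemma parseval:
  assumes "orthonormal_on d {..<d} u"
  shows "(\<Sum>i<d. (cmod (\<Sum>x<d. f x * cnj (u i x)))\<^sup>2) = (\<Sum>x<d. (cmod (f x))\<^sup>2)"
  using sum_norm_square_combination[OF assms _ orthonormal_on_expansion[OF assms], of f] by simp

text \<open>Otherwise the first \<open>d\<close> members already form a basis, and member
  \<open>d\<close>, orthogonal to all of them, would have norm 0 by Parseval.\<close>

lemma orthonormal_on_size_le:
  assumes "orthonormal_on d {..<m} u"
  shows "m \<le> d"
proof (rule ccontr)
  assume "\<not> m \<le> d"
  then have "orthonormal_on d {..<d} u" "d \<in> {..<m}"
    using orthonormal_on_subset[OF assms] by auto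
  from parseval[OF this(1), of "u d"]
  have "(\<Sum>x<d. (cmod (u d x))\<^sup>2) = 0"
    using orthonormal_onD[OF assms, of d] \<open>d \<in> {..<m}\<close> by simp
  then have "(\<Sum>x<d. u d x * cnj (u d x)) = 0"
    unfolding sum_mult_cnj_eq_sum_norm by simp
  then show False using orthonormal_onD[OF assms, of d d] \<open>d \<in> {..<m}\<close> by simp
qed

text \<open>The family is numbered and completed to an orthonormal basis; Parseval for that basis is
  then truncated to the given members.\<close>

lemma bessel:
  assumes "orthonormal_on d I u" "finite I"
  shows "(\<Sum>i\<in>I. (cmod (\<Sum>x<d. f x * cnj (u i x)))\<^sup>2) \<le> (\<Sum>x<d. (cmod (f x))\<^sup>2)"
proof -
  obtain e where e: "bij_betw e {..<card I} I"
    using ex_bij_betw_nat_finite[OF assms(2)] by (auto simp: atLeast0LessThan)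
  have *: "orthonormal_on d {..<card I} (\<lambda>i. u (e i))"
    by (rule orthonormal_on_reindex[OF assms(1)]) (use e in \<open>auto simp: bij_betw_def\<close>)
  have le: "card I \<le> d" by (rule orthonormal_on_size_le[OF *])
  obtain v where v: "orthonormal_on d {..<d} v" "\<forall>i<card I. v i = u (e i)"
    using orthonormal_on_extend[OF * le] by blast
  have "(\<Sum>i\<in>I. (cmod (\<Sum>x<d. f x * cnj (u i x)))\<^sup>2) =
      (\<Sum>i<card I. (cmod (\<Sum>x<d. f x * cnj (u (e i) x)))\<^sup>2)"
    by (rule sum.reindex_bij_betw[OF e, symmetric])
  also have "\<dots> = (\<Sum>i<card I. (cmod (\<Sum>x<d. f x * cnj (v i x)))\<^sup>2)"
    using v(2) by simp
  also have "\<dots> \<le> (\<Sum>i<d. (cmod (\<Sum>x<d. f x * cnj (v i x)))\<^sup>2)"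
    using le by (intro sum_mono2) auto
  also have "\<dots> = (\<Sum>x<d. (cmod (f x))\<^sup>2)" by (rule parseval[OF v(1)])
  finally show ?thesis .
qed

text \<open>Double counting: the squared overlaps of the two families sum to the first cardinality,
  and by Bessel to at most the second.\<close>

lemma orthonormal_on_card_le_of_span:
  assumes u: "orthonormal_on d I u" "finite I" and v: "orthonormal_on d J v" "finite J"
    and span: "\<And>i x. i \<in> I \<Longrightarrow> x < d \<Longrightarrow> u i x = (\<Sum>j\<in>J. c i j * v j x)"
  shows "card I \<le> card J"
proof -
  have norm: "(\<Sum>x<d. (cmod (w i x))\<^sup>2) = 1" if "orthonormal_on d K w" "i \<in> K"
    for w and K :: "'k set" and i
    using orthonormal_onD[OF that that(2)] unfolding sum_mult_cnj_eq_sum_norm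
    by (simp only: refl if_True of_real_eq_1_iff)
  \<comment> \<open>Pairing with \<open>v j\<close> recovers the coefficient. The inner product is
    then flipped, at the price of a conjugation, so that Bessel applies to the vector
    \<open>v j\<close> and the family \<open>u\<close>.\<close>
  have c: "cmod (c i j) = cmod (\<Sum>x<d. v j x * cnj (u i x))" if "i \<in> I" "j \<in> J" for i j
  proof -
    have "(\<Sum>x<d. u i x * cnj (v j x)) = (\<Sum>x<d. \<Sum>k\<in>J. c i k * (v k x * cnj (v j x)))"
      using that span by (intro sum.cong refl) (simp add: sum_distrib_left sum_distrib_right mult_ac)
    also have "\<dots> = (\<Sum>k\<in>J. c i k * (\<Sum>x<d. v k x * cnj (v j x)))"
      by (subst sum.swap) (simp add: sum_distrib_left)
    also have "\<dots> = c i j"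
      using that v by (simp add: orthonormal_onD if_distrib cong: if_cong)
    finally have "c i j = cnj (\<Sum>x<d. v j x * cnj (u i x))" by (simp add: mult.commute)
    then show ?thesis by (metis complex_mod_cnj)
  qed
  have "real (card I) = (\<Sum>i\<in>I. \<Sum>x<d. (cmod (u i x))\<^sup>2)"
    using norm[OF u(1)] by simp
  also have "\<dots> = (\<Sum>i\<in>I. \<Sum>j\<in>J. (cmod (c i j))\<^sup>2)"
    by (intro sum.cong refl sum_norm_square_combination[OF v] span)
  also have "\<dots> = (\<Sum>j\<in>J. \<Sum>i\<in>I. (cmod (\<Sum>x<d. v j x * cnj (u i x)))\<^sup>2)"
    by (subst sum.swap) (simp add: c)
  also have "\<dots> \<le> (\<Sum>j\<in>J. \<Sum>x<d. (cmod (v j x))\<^sup>2)"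
    by (intro sum_mono bessel[OF u])
  also have "\<dots> = real (card J)"
    using norm[OF v(1)] by simp
  finally show ?thesis by simp
qed

section \<open>The spectral theorem and the singular value decomposition\<close>

text \<open>Induction on the number \<open>m\<close> of eigenvectors found. They are completed to a
  basis in which \<open>H\<close> is block triangular; an eigenvector of the remaining block,
  extended by zeros, yields the next one.\<close>

lemma hermitian_orthonormal_eigenvectors:
  fixes H :: "nat \<Rightarrow> nat \<Rightarrow> complex"
  assumes herm: "\<And>x y. x < d \<Longrightarrow> y < d \<Longrightarrow> H x y = cnj (H y x)" and "m \<le> d"
  shows "\<exists>u ev. orthonormal_on d {..<m} u \<and> (\<forall>i<m. \<forall>x<d. (\<Sum>y<d. H x y * u i y) = ev i * u i x)"
  using \<open>m \<le> d\<close>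
proof (induction m)
  case 0
  then show ?case by (auto simp: orthonormal_on_def)
next
  case (Suc m)
  then obtain u0 ev where u0: "orthonormal_on d {..<m} u0"
    and ev0: "\<And>i x. i < m \<Longrightarrow> x < d \<Longrightarrow> (\<Sum>y<d. H x y * u0 i y) = ev i * u0 i x"
    using Suc_leD by blast
  obtain u where u: "orthonormal_on d {..<d} u" "\<forall>i<m. u i = u0 i"
    using orthonormal_on_extend[OF u0 Suc_leD[OF Suc.prems]] by blast
  have ev: "(\<Sum>y<d. H x y * u i y) = ev i * u i x" if "i < m" "x < d" for i x
    using ev0 u(2) that by simp
  \<comment> \<open>The matrix of \<open>H\<close> in the basis \<open>u\<close>.\<close>
  define K where "K i j = (\<Sum>x<d. cnj (u i x) * (\<Sum>y<d. H x y * u j y))" for i j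
  have "0 < d - m" using Suc.prems by simp
  then obtain c z where z: "\<exists>j<d - m. z j \<noteq> 0"
      "\<And>i. i < d - m \<Longrightarrow> (\<Sum>j<d - m. K (i + m) (j + m) * z j) = c * z i"
    by (rule complex_matrix_has_eigenvector[where A = "\<lambda>i j. K (i + m) (j + m)"]) (rule that)
  define z' where "z' j = (if j < m then 0 else z (j - m))" for j
  \<comment> \<open>Hermitian symmetry moves \<open>H\<close> onto \<open>u i\<close>, an
    eigenvector orthogonal to \<open>u j\<close>, so the upper right block of \<open>K\<close>
    vanishes. As \<open>z'\<close> is zero on the first \<open>m\<close> entries, it is then an
    eigenvector of all of \<open>K\<close>.\<close>
  have K0: "K i j = 0" if "i < m" "m \<le> j" "j < d" for i j
  proof -
    have *: "(\<Sum>x<d. cnj (u i x) * H x y) = cnj (ev i) * cnj (u i y)" if "y < d" for y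
    proof -
      have "(\<Sum>x<d. cnj (u i x) * H x y) = (\<Sum>x<d. cnj (u i x) * cnj (H y x))"
        by (intro sum.cong refl arg_cong2[where f = "(*)"] herm) (use that in auto)
      also have "\<dots> = cnj (\<Sum>x<d. H y x * u i x)" by (simp add: mult.commute)
      finally show ?thesis using ev[OF \<open>i < m\<close> that] by simp
    qed
    have "K i j = (\<Sum>y<d. (\<Sum>x<d. cnj (u i x) * H x y) * u j y)"
      unfolding K_def by (simp add: sum_distrib_left sum_distrib_right mult_ac, subst sum.swap) simp
    also have "\<dots> = (\<Sum>y<d. cnj (ev i) * cnj (u i y) * u j y)"
      by (intro sum.cong refl) (simp only: * lessThan_iff)
    also have "\<dots> = cnj (ev i) * (\<Sum>y<d. u j y * cnj (u i y))"
      by (simp add: sum_distrib_left mult_ac)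
    also have "\<dots> = 0" using orthonormal_onD[OF u(1), of j i] that by simp
    finally show ?thesis .
  qed
  have Kz: "(\<Sum>j<d. K i j * z' j) = c * z' i" if "i < d" for i
  proof (cases "i < m")
    case True
    then show ?thesis using K0 by (auto simp: z'_def intro!: sum.neutral)
  next
    case False
    have "(\<Sum>j<d. K i j * z' j) = (\<Sum>j\<in>{m..<d}. K i j * z' j)"
      by (rule sum.mono_neutral_right) (auto simp: z'_def)
    also have "\<dots> = (\<Sum>j<d - m. K i (j + m) * z j)"
      using Suc.prems by (intro sum.reindex_bij_witness[of _ "\<lambda>j. j + m" "\<lambda>j. j - m"]) (auto simp: z'_def)
    also have "\<dots> = c * z' i"
      using z(2)[of "i - m"] False that by (simp add: z'_def)
    finally show ?thesis .
  qed
  define v where "v x = (\<Sum>j<d. z' j * u j x)" for x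
  have coeff: "(\<Sum>x<d. v x * cnj (u i x)) = z' i" if "i < d" for i
  proof -
    have "(\<Sum>x<d. v x * cnj (u i x)) = (\<Sum>j<d. z' j * (\<Sum>x<d. u j x * cnj (u i x)))"
      unfolding v_def by (simp add: sum_distrib_left sum_distrib_right mult_ac, subst sum.swap) simp
    also have "\<dots> = z' i"
      using that by (simp add: orthonormal_onD[OF u(1)] if_distrib cong: if_cong)
    finally show ?thesis .
  qed
  \<comment> \<open>Both sides have the coefficients \<open>c * z' i\<close> in the basis
    \<open>u\<close> and hence agree by the expansion.\<close>
  have Hv: "(\<Sum>y<d. H x y * v y) = c * v x" if "x < d" for x
  proof -
    define g where "g x = (\<Sum>y<d. H x y * v y)" for x
    have "g x = (\<Sum>j<d. z' j * (\<Sum>y<d. H x y * u j y))" for x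
      unfolding g_def v_def
      by (simp add: sum_distrib_left mult_ac, subst sum.swap) simp
    then have "(\<Sum>x<d. g x * cnj (u i x)) = (\<Sum>j<d. K i j * z' j)" for i
      unfolding K_def
      by (simp add: sum_distrib_left sum_distrib_right mult_ac, subst sum.swap) simp
    with Kz have "(\<Sum>x<d. g x * cnj (u i x)) = c * z' i" if "i < d" for i
      using that by simp
    then have "g x = c * v x"
      using orthonormal_on_expansion[OF u(1) that, of g]
      by (simp add: v_def sum_distrib_left mult_ac)
    then show ?thesis by (simp add: g_def)
  qed
  have "\<exists>x<d. v x \<noteq> 0"
  proof (rule ccontr)
    assume "\<not> (\<exists>x<d. v x \<noteq> 0)"
    then have "z' i = 0" if "i < d" for i using coeff[OF that] by simp
    moreover obtain j where "j < d - m" "z j \<noteq> 0" using z(1) by blast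
    ultimately show False by (metis add_diff_cancel_right' less_diff_conv not_add_less2 z'_def)
  qed
  then obtain b where b: "(\<Sum>x<d. (b * v x) * cnj (b * v x)) = 1"
    using normalize_nonzero by blast
  \<comment> \<open>The zero padding of \<open>z'\<close> makes the new eigenvector orthogonal to
    those already found.\<close>
  have "(\<Sum>x<d. cnj (u i x) * (b * v x)) = 0" if "i < m" for i
  proof -
    have "(\<Sum>x<d. cnj (u i x) * (b * v x)) = b * (\<Sum>x<d. v x * cnj (u i x))"
      by (simp add: sum_distrib_left mult_ac)
    then show ?thesis using that coeff[of i] Suc.prems by (simp add: z'_def)
  qed
  then have "orthonormal_on d {..<Suc m} (u(m := \<lambda>x. b * v x))"
    using Suc.prems b by (intro orthonormal_on_insert orthonormal_on_subset[OF u(1)]) auto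
  moreover have "(\<Sum>y<d. H x y * (u(m := \<lambda>x. b * v x)) i y) = (ev(m := c)) i * (u(m := \<lambda>x. b * v x)) i x"
    if "i < Suc m" "x < d" for i x
  proof (cases "i = m")
    case True
    have "(\<Sum>y<d. H x y * (b * v y)) = b * (\<Sum>y<d. H x y * v y)"
      by (simp add: sum_distrib_left mult_ac)
    then show ?thesis using True Hv[OF that(2)] by simp
  next
    case False
    then show ?thesis using ev[of i x] that by simp
  qed
  ultimately show ?case by blast
qed

text \<open>Let \<open>v\<close> be an orthonormal eigenbasis of the adjoint of \<open>M\<close>
  times \<open>M\<close>. The images of its members under \<open>M\<close> are mutually orthogonal,
  and the nonzero ones, normalised, form \<open>p\<close>. The family \<open>q\<close> consists of
  conjugates of members of \<open>v\<close>, since \<open>p l i * q l j\<close> carries no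
  conjugation.\<close>

lemma singular_value_decomposition:
  fixes M :: "nat \<Rightarrow> nat \<Rightarrow> complex"
  shows "\<exists>(L :: nat set) w p q. finite L \<and> orthonormal_on d1 L p \<and> orthonormal_on d2 L q \<and>
    (\<forall>i<d1. \<forall>j<d2. M i j = (\<Sum>l\<in>L. w l * (p l i * q l j)))"
proof -
  \<comment> \<open>The Gram matrix of the columns of \<open>M\<close>.\<close>
  define H where "H j k = (\<Sum>i<d1. cnj (M i j) * M i k)" for j k
  have "H j k = cnj (H k j)" for j k by (simp add: H_def mult.commute)
  from hermitian_orthonormal_eigenvectors[of d2 H d2, OF this order_refl] obtain v ev
    where v: "orthonormal_on d2 {..<d2} v"
      and ev: "\<And>l j. l < d2 \<Longrightarrow> j < d2 \<Longrightarrow> (\<Sum>k<d2. H j k * v l k) = ev l * v l j" by blast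
  define P where "P l i = (\<Sum>j<d2. M i j * v l j)" for l i
  have PP: "(\<Sum>i<d1. P l i * cnj (P k i)) = ev l * (if l = k then 1 else 0)"
    if "l < d2" "k < d2" for l k
  proof -
    have "(\<Sum>i<d1. P l i * cnj (P k i)) =
        (\<Sum>i<d1. \<Sum>j<d2. \<Sum>j'<d2. cnj (v k j) * (cnj (M i j) * M i j' * v l j'))"
      unfolding P_def by (simp add: sum_distrib_left sum_distrib_right mult_ac)
    also have "\<dots> = (\<Sum>j<d2. \<Sum>j'<d2. \<Sum>i<d1. cnj (v k j) * (cnj (M i j) * M i j' * v l j'))"
      by (simp add: sum.swap[of _ _ "{..<d1}"])
    also have "\<dots> = (\<Sum>j<d2. cnj (v k j) * (\<Sum>j'<d2. H j j' * v l j'))"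
      unfolding H_def by (simp add: sum_distrib_left sum_distrib_right mult_ac)
    also have "\<dots> = ev l * (\<Sum>j<d2. v l j * cnj (v k j))"
      using ev that by (simp add: sum_distrib_left mult_ac)
    finally show ?thesis using orthonormal_onD[OF v, of l k] that by simp
  qed
  define s where "s l = (\<Sum>i<d1. (cmod (P l i))\<^sup>2)" for l
  define L where "L = {l. l < d2 \<and> s l \<noteq> 0}"
  define w where "w l = complex_of_real (sqrt (s l))" for l
  \<comment> \<open>The case \<open>l = k\<close> of \<open>PP\<close>: each eigenvalue is a squared
    norm, hence real and nonnegative, and its square root is the singular value
    \<open>w l\<close>.\<close>
  have ev_s: "ev l = complex_of_real (s l)" if "l < d2" for l
    using PP[OF that that] unfolding s_def sum_mult_cnj_eq_sum_norm by simp
  have s_nonneg: "s l \<ge> 0" for l by (simp add: s_def sum_nonneg)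
  have w2: "w l * cnj (w l) = complex_of_real (s l)" for l
    using s_nonneg[of l] by (simp add: w_def flip: of_real_mult)
  have w0: "w l \<noteq> 0" if "l \<in> L" for l using that by (simp add: w_def L_def)
  define p where "p l i = P l i / w l" for l i
  have "orthonormal_on d1 L p"
    unfolding orthonormal_on_def
  proof (intro ballI)
    fix l k assume lk: "l \<in> L" "k \<in> L"
    have "(\<Sum>i<d1. p l i * cnj (p k i)) = (\<Sum>i<d1. P l i * cnj (P k i)) / (w l * cnj (w k))"
      unfolding p_def by (simp add: sum_divide_distrib)
    also have "\<dots> = (if l = k then 1 else 0)"
      using lk PP[of l k] ev_s[of l] w2[of l] by (auto simp: L_def)
    finally show "(\<Sum>i<d1. p l i * cnj (p k i)) = (if l = k then 1 else 0)" .
  qed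
  moreover have "orthonormal_on d2 L (\<lambda>l j. cnj (v l j))"
    by (rule orthonormal_on_subset[OF orthonormal_on_cnj[OF v]]) (auto simp: L_def)
  moreover have "M i j = (\<Sum>l\<in>L. w l * (p l i * cnj (v l j)))" if "i < d1" "j < d2" for i j
  proof -
    have "M i j = (\<Sum>l<d2. P l i * cnj (v l j))"
      using orthonormal_on_expansion[OF orthonormal_on_cnj[OF v] that(2), of "M i"]
      by (simp add: P_def)
    also have "\<dots> = (\<Sum>l\<in>L. P l i * cnj (v l j))"
    proof (rule sum.mono_neutral_right)
      \<comment> \<open>The dropped terms are zero because \<open>s l = 0\<close> forces every
        \<open>P l i\<close> to vanish.\<close>
      show "\<forall>l\<in>{..<d2} - L. P l i * cnj (v l j) = 0"
        using that by (auto simp: L_def s_def sum_nonneg_eq_0_iff)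
    qed (auto simp: L_def)
    also have "\<dots> = (\<Sum>l\<in>L. w l * (p l i * cnj (v l j)))"
      using w0 by (intro sum.cong refl) (simp add: p_def)
    finally show ?thesis .
  qed
  moreover have "finite L" by (simp add: L_def)
  ultimately show ?thesis by blast
qed

section \<open>Schmidt decomposition and Schmidt rank\<close>

lemma restrict_index_lower: "restrict_index [0..<k] x = x mod 2 ^ k"
  by (simp add: restrict_index_def horner_sum_bit_eq_take_bit take_bit_eq_mod)

lemma restrict_index_upper:
  assumes "x < 2 ^ (k1 + k2)"
  shows "restrict_index [k1..<k1 + k2] x = x div 2 ^ k1"
proof -
  have "map (bit x) [k1..<k1 + k2] = map (bit (drop_bit k1 x)) [0..<k2]"
    by (rule nth_equalityI) (auto simp: bit_drop_bit_eq)
  then have "restrict_index [k1..<k1 + k2] x = take_bit k2 (drop_bit k1 x)"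
    by (simp add: restrict_index_def horner_sum_bit_eq_take_bit)
  also have "\<dots> = x div 2 ^ k1"
    using assms by (simp add: take_bit_nat_eq_self_iff drop_bit_eq_div less_mult_imp_div_less power_add mult.commute)
  finally show ?thesis .
qed

lemma sum_lessThan_mult:
  fixes f :: "nat \<Rightarrow> 'a :: comm_monoid_add"
  shows "(\<Sum>x<a * b. f x) = (\<Sum>j<b. \<Sum>i<a. f (i + a * j))"
proof -
  have "(\<Sum>x<a * b. f x) = (\<Sum>j<b. sum f {j * a..<j * a + a})"
    by (simp add: sum.nat_group mult.commute)
  also have "\<dots> = (\<Sum>j<b. \<Sum>i<a. f (i + a * j))"
  proof (rule sum.cong[OF refl])
    fix j
    show "sum f {j * a..<j * a + a} = (\<Sum>i<a. f (i + a * j))"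
      by (rule sum.reindex_bij_witness[of _ "\<lambda>i. i + a * j" "\<lambda>x. x - a * j"])
        (auto simp: mult.commute)
  qed
  finally show ?thesis .
qed

lemma index_AB_less:
  "(i::nat) < 2 ^ k1 \<Longrightarrow> j < 2 ^ k2 \<Longrightarrow> i + 2 ^ k1 * j < 2 ^ (k1 + k2)"
proof -
  assume "i < 2 ^ k1" "j < 2 ^ k2"
  then have "i + 2 ^ k1 * j < 2 ^ k1 * Suc j" "2 ^ k1 * Suc j \<le> 2 ^ k1 * 2 ^ k2"
    by (simp, intro mult_le_mono) auto
  then show ?thesis by (simp add: power_add)
qed

lemma all_index_AB:
  "(\<forall>x < 2 ^ (k1 + k2). Q (x mod 2 ^ k1) (x div 2 ^ k1)) \<longleftrightarrow>
     (\<forall>i < 2 ^ k1. \<forall>j < 2 ^ k2. Q i (j::nat))"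
proof safe
  fix i j :: nat
  assume *: "\<forall>x < 2 ^ (k1 + k2). Q (x mod 2 ^ k1) (x div 2 ^ k1)" and "i < 2 ^ k1" "j < 2 ^ k2"
  then show "Q i j" using *[rule_format, OF index_AB_less[of i k1 j k2]] by simp
qed (simp add: less_mult_imp_div_less power_add mult.commute)

text \<open>The state reshaped into a matrix with rows indexed by \<open>A\<close> and columns by
  \<open>B\<close>. A Schmidt decomposition of the state is a singular value decomposition of this
  matrix.\<close>

definition schmidt_coeff :: "nat \<Rightarrow> complex vec \<Rightarrow> nat \<Rightarrow> nat \<Rightarrow> complex" where
  "schmidt_coeff k1 \<psi> i j = \<psi> $ (i + 2 ^ k1 * j)"

lemma eq_schmidt_vec_iff:
  assumes "\<psi> \<in> carrier_vec (2 ^ (k1 + k2))"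
  shows "\<psi> = vec (2 ^ (k1 + k2)) (\<lambda>x. \<Sum>l\<in>I. w l * tensor_AB k1 k2 (a l) (b l) $ x) \<longleftrightarrow>
    (\<forall>i<2 ^ k1. \<forall>j<2 ^ k2. schmidt_coeff k1 \<psi> i j = (\<Sum>l\<in>I. w l * (a l $ i * b l $ j)))"
proof -
  have "\<psi> = vec (2 ^ (k1 + k2)) (\<lambda>x. \<Sum>l\<in>I. w l * tensor_AB k1 k2 (a l) (b l) $ x) \<longleftrightarrow>
    (\<forall>x<2 ^ (k1 + k2). \<psi> $ x = (\<Sum>l\<in>I. w l * (a l $ (x mod 2 ^ k1) * b l $ (x div 2 ^ k1))))"
    using assms
    by (auto simp: vec_eq_iff tensor_AB_def restrict_index_lower restrict_index_upper)
  also have "\<dots> \<longleftrightarrow> (\<forall>x<2 ^ (k1 + k2). schmidt_coeff k1 \<psi> (x mod 2 ^ k1) (x div 2 ^ k1) =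
      (\<Sum>l\<in>I. w l * (a l $ (x mod 2 ^ k1) * b l $ (x div 2 ^ k1))))"
    by (simp add: schmidt_coeff_def)
  also have "\<dots> \<longleftrightarrow> (\<forall>i<2 ^ k1. \<forall>j<2 ^ k2. schmidt_coeff k1 \<psi> i j = (\<Sum>l\<in>I. w l * (a l $ i * b l $ j)))"
    by (rule all_index_AB)
  finally show ?thesis .
qed

text \<open>The squared norm 1 of the state is summed column by column: for fixed \<open>j\<close>,
  Pythagoras applies to the family \<open>p\<close> with coefficients \<open>w l * q l j\<close>,
  and summing over \<open>j\<close> uses that each \<open>q l\<close> is a unit vector.\<close>

lemma sum_schmidt_weights:
  assumes \<psi>: "pure_state (k1 + k2) \<psi>" and "finite I"
    and p: "orthonormal_on (2 ^ k1) I p" and q: "orthonormal_on (2 ^ k2) I q"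
    and eq: "\<And>i j. i < 2 ^ k1 \<Longrightarrow> j < 2 ^ k2 \<Longrightarrow> schmidt_coeff k1 \<psi> i j = (\<Sum>l\<in>I. w l * (p l i * q l j))"
  shows "(\<Sum>l\<in>I. (cmod (w l))\<^sup>2) = 1"
proof -
  have "complex_of_real (\<Sum>x<2 ^ (k1 + k2). (cmod (\<psi> $ x))\<^sup>2) = 1"
    using \<psi> unfolding sum_mult_cnj_eq_sum_norm[symmetric] by (auto simp: pure_state_def cinner_conv_sum)
  then have "1 = (\<Sum>x<2 ^ k1 * 2 ^ k2. (cmod (\<psi> $ x))\<^sup>2)"
    by (simp only: of_real_eq_1_iff power_add)
  also have "\<dots> = (\<Sum>j<2 ^ k2. \<Sum>i<2 ^ k1. (cmod (schmidt_coeff k1 \<psi> i j))\<^sup>2)"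
    by (simp add: sum_lessThan_mult schmidt_coeff_def)
  also have "\<dots> = (\<Sum>j<2 ^ k2. \<Sum>l\<in>I. (cmod (w l * q l j))\<^sup>2)"
    using eq by (intro sum.cong refl sum_norm_square_combination[OF p \<open>finite I\<close>]) (simp add: mult_ac)
  also have "\<dots> = (\<Sum>l\<in>I. (cmod (w l))\<^sup>2 * (\<Sum>j<2 ^ k2. (cmod (q l j))\<^sup>2))"
    by (subst sum.swap) (simp add: norm_mult power_mult_distrib sum_distrib_left)
  also have "\<dots> = (\<Sum>l\<in>I. (cmod (w l))\<^sup>2)"
  proof (intro sum.cong refl)
    fix l assume "l \<in> I"
    then have "(\<Sum>j<2 ^ k2. (cmod (q l j))\<^sup>2) = 1"
      using orthonormal_onD[OF q, of l l] unfolding sum_mult_cnj_eq_sum_norm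
      by (simp only: refl if_True of_real_eq_1_iff)
    then show "(cmod (w l))\<^sup>2 * (\<Sum>j<2 ^ k2. (cmod (q l j))\<^sup>2) = (cmod (w l))\<^sup>2" by simp
  qed
  finally show ?thesis by simp
qed

text \<open>An arbitrary finite index set is renumbered to an initial segment, which allows terms of
  weight zero to be discarded. The weights inherit their normalisation from the state.\<close>

lemma schmidt_decomposition_of_indexed:
  assumes \<psi>: "pure_state (k1 + k2) \<psi>" and "finite (I :: nat set)"
    and p: "orthonormal_on (2 ^ k1) I p" and q: "orthonormal_on (2 ^ k2) I q"
    and eq: "\<And>i j. i < 2 ^ k1 \<Longrightarrow> j < 2 ^ k2 \<Longrightarrow> schmidt_coeff k1 \<psi> i j = (\<Sum>l\<in>I. w l * (p l i * q l j))"
  shows "\<exists>w a b. schmidt_decomposition k1 k2 \<psi> (card I) w a b"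
proof -
  obtain e where e: "bij_betw e {..<card I} I"
    using ex_bij_betw_nat_finite[OF \<open>finite I\<close>] by (auto simp: atLeast0LessThan)
  then have inj: "inj_on e {..<card I}" and im: "e ` {..<card I} \<subseteq> I" by (auto simp: bij_betw_def)
  define a where "a l = vec (2 ^ k1) (p (e l))" for l
  define b where "b l = vec (2 ^ k2) (q (e l))" for l
  have "orthonormal_on (2 ^ k1) {..<card I} (\<lambda>l i. a l $ i)"
    using orthonormal_on_reindex[OF p inj im]
    by (subst orthonormal_on_cong[of _ _ _ "\<lambda>l. p (e l)"]) (auto simp: a_def)
  moreover have "orthonormal_on (2 ^ k2) {..<card I} (\<lambda>l i. b l $ i)"
    using orthonormal_on_reindex[OF q inj im]
    by (subst orthonormal_on_cong[of _ _ _ "\<lambda>l. q (e l)"]) (auto simp: b_def)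
  moreover have "(\<Sum>l<card I. (cmod (w (e l)))\<^sup>2) = 1"
    using sum_schmidt_weights[OF assms] sum.reindex_bij_betw[OF e, of "\<lambda>l. (cmod (w l))\<^sup>2"] by simp
  moreover have "schmidt_coeff k1 \<psi> i j = (\<Sum>l<card I. w (e l) * (a l $ i * b l $ j))"
    if "i < 2 ^ k1" "j < 2 ^ k2" for i j
    using eq[OF that] that sum.reindex_bij_betw[OF e, of "\<lambda>l. w l * (p l i * q l j)"]
    by (simp add: a_def b_def)
  ultimately have "schmidt_decomposition k1 k2 \<psi> (card I) (\<lambda>l. w (e l)) a b"
    using \<psi> unfolding schmidt_decomposition_def orthonormal_family_iff pure_state_def
    by (auto simp: eq_schmidt_vec_iff a_def b_def)
  then show ?thesis by blast
qed

section \<open>Uniqueness of the Schmidt rank and a decomposition of that length\<close>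

lemma schmidt_decomposition_coeff:
  assumes "schmidt_decomposition k1 k2 \<psi> m w a b" "i < 2 ^ k1" "j < 2 ^ k2"
  shows "schmidt_coeff k1 \<psi> i j = (\<Sum>l<m. w l * (a l $ i * b l $ j))"
proof -
  have *: "\<psi> = vec (2 ^ (k1 + k2)) (\<lambda>x. \<Sum>l<m. w l * tensor_AB k1 k2 (a l) (b l) $ x)"
    using assms(1) by (simp add: schmidt_decomposition_def)
  then have "\<psi> \<in> carrier_vec (2 ^ (k1 + k2))" by (metis vec_carrier)
  from eq_schmidt_vec_iff[OF this] * assms(2,3) show ?thesis by blast
qed

lemma schmidt_decomposition_orthonormal_on:
  assumes "schmidt_decomposition k1 k2 \<psi> m w a b"
  shows "orthonormal_on (2 ^ k1) {..<m} (\<lambda>l i. a l $ i)" "orthonormal_on (2 ^ k2) {..<m} (\<lambda>l i. b l $ i)"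
  using assms by (auto simp: schmidt_decomposition_def orthonormal_family_iff)

text \<open>Contracting the \<open>B\<close> side with \<open>b l\<close> isolates
  \<open>w l * a l\<close> in the first decomposition; in the second, the result is a combination of
  the \<open>a' k\<close> of nonzero weight. Hence every \<open>a l\<close> of nonzero weight lies
  in their span, and the cardinality bound applies.\<close>

lemma schmidt_rank_le:
  assumes S: "schmidt_decomposition k1 k2 \<psi> m w a b" and S': "schmidt_decomposition k1 k2 \<psi> m' w' a' b'"
  shows "card {l. l < m \<and> w l \<noteq> 0} \<le> card {l. l < m' \<and> w' l \<noteq> 0}"
proof -
  let ?I = "{l. l < m \<and> w l \<noteq> 0}" and ?J = "{l. l < m' \<and> w' l \<noteq> 0}"
  note on = schmidt_decomposition_orthonormal_on[OF S] and on' = schmidt_decomposition_orthonormal_on[OF S']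
  define c where "c l k = w' k * (\<Sum>j<2 ^ k2. b' k $ j * cnj (b l $ j)) / w l" for l k
  show ?thesis
  proof (rule orthonormal_on_card_le_of_span)
    fix l i assume l: "l \<in> ?I" and i: "i < (2::nat) ^ k1"
    have "(\<Sum>j<2 ^ k2. schmidt_coeff k1 \<psi> i j * cnj (b l $ j)) =
        (\<Sum>j<2 ^ k2. \<Sum>k<m. w k * a k $ i * (b k $ j * cnj (b l $ j)))"
      using schmidt_decomposition_coeff[OF S i]
      by (intro sum.cong refl) (simp add: sum_distrib_left sum_distrib_right mult_ac)
    also have "\<dots> = (\<Sum>k<m. w k * a k $ i * (\<Sum>j<2 ^ k2. b k $ j * cnj (b l $ j)))"
      by (subst sum.swap) (simp add: sum_distrib_left)
    also have "\<dots> = w l * a l $ i"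
      using l by (simp add: orthonormal_onD[OF on(2)] if_distrib cong: if_cong)
    finally have "a l $ i = (\<Sum>j<2 ^ k2. schmidt_coeff k1 \<psi> i j * cnj (b l $ j)) / w l"
      using l by simp
    also have "(\<Sum>j<2 ^ k2. schmidt_coeff k1 \<psi> i j * cnj (b l $ j)) =
        (\<Sum>j<2 ^ k2. \<Sum>k<m'. w' k * a' k $ i * (b' k $ j * cnj (b l $ j)))"
      using schmidt_decomposition_coeff[OF S' i]
      by (intro sum.cong refl) (simp add: sum_distrib_left sum_distrib_right mult_ac)
    also have "\<dots> = (\<Sum>k<m'. w' k * a' k $ i * (\<Sum>j<2 ^ k2. b' k $ j * cnj (b l $ j)))"
      by (subst sum.swap) (simp add: sum_distrib_left)
    also have "\<dots> = (\<Sum>k\<in>?J. w' k * a' k $ i * (\<Sum>j<2 ^ k2. b' k $ j * cnj (b l $ j)))"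
      by (rule sum.mono_neutral_right) auto
    finally show "a l $ i = (\<Sum>k\<in>?J. c l k * a' k $ i)"
      by (simp add: c_def sum_divide_distrib mult_ac)
  qed (auto intro: orthonormal_on_subset[OF on(1)] orthonormal_on_subset[OF on'(1)])
qed

text \<open>The definite description is justified by the previous inequality, taken in both
  directions.\<close>

lemma schmidt_rank_eq:
  assumes "schmidt_decomposition k1 k2 \<psi> m w a b"
  shows "schmidt_rank k1 k2 \<psi> = card {l. l < m \<and> w l \<noteq> 0}"
  unfolding schmidt_rank_def
  by (rule the_equality) (use assms in \<open>blast intro: antisym schmidt_rank_le\<close>)+

text \<open>A singular value decomposition of the coefficient matrix gives some Schmidt
  decomposition; keeping only its nonzero weights makes its length equal to the rank.\<close>

lemma schmidt_decomposition_of_schmidt_rank: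
  assumes "pure_state (k1 + k2) \<psi>"
  shows "\<exists>w a b. schmidt_decomposition k1 k2 \<psi> (schmidt_rank k1 k2 \<psi>) w a b"
proof -
  obtain L w p q where L: "finite (L :: nat set)" "orthonormal_on (2 ^ k1) L p" "orthonormal_on (2 ^ k2) L q"
    "\<And>i j. i < 2 ^ k1 \<Longrightarrow> j < 2 ^ k2 \<Longrightarrow> schmidt_coeff k1 \<psi> i j = (\<Sum>l\<in>L. w l * (p l i * q l j))"
    using singular_value_decomposition[of "2 ^ k1" "2 ^ k2" "schmidt_coeff k1 \<psi>"] by blast
  obtain w a b where S: "schmidt_decomposition k1 k2 \<psi> (card L) w a b"
    using schmidt_decomposition_of_indexed[OF assms L] by blast
  let ?I = "{l. l < card L \<and> w l \<noteq> 0}"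
  note on = schmidt_decomposition_orthonormal_on[OF S]
  have "\<exists>w a b. schmidt_decomposition k1 k2 \<psi> (card ?I) w a b"
  proof (rule schmidt_decomposition_of_indexed[OF assms])
    fix i j :: nat assume "i < 2 ^ k1" "j < 2 ^ k2"
    from schmidt_decomposition_coeff[OF S this]
    show "schmidt_coeff k1 \<psi> i j = (\<Sum>l\<in>?I. w l * (a l $ i * b l $ j))"
      by (simp, intro sum.mono_neutral_right) auto
  qed (auto intro: orthonormal_on_subset[OF on(1)] orthonormal_on_subset[OF on(2)])
  then show ?thesis using schmidt_rank_eq[OF S] by simp
qed

section \<open>Circuits\<close>

lemma bit_imp_less_of_less_exp: "(x::nat) < 2 ^ n \<Longrightarrow> bit x q \<Longrightarrow> q < n"
  by (metis bit_take_bit_iff take_bit_nat_eq_self)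

text \<open>This rewrites the locality condition of \<open>apply_on\<close> for gates on
  \<open>A\<close>. The bounds on \<open>x\<close> and \<open>y\<close> make all bits from position
  \<open>k1 + k2\<close> on zero, so the quotients are determined by the qubits of
  \<open>B\<close>.\<close>

lemma agree_off_A_iff:
  assumes "(x::nat) < 2 ^ (k1 + k2)" "(y::nat) < 2 ^ (k1 + k2)"
  shows "(\<forall>q<k1 + k2. q \<notin> set [0..<k1] \<longrightarrow> bit x q = bit y q) \<longleftrightarrow> x div 2 ^ k1 = y div 2 ^ k1"
proof
  assume *: "\<forall>q<k1 + k2. q \<notin> set [0..<k1] \<longrightarrow> bit x q = bit y q"
  have "bit x (k1 + q) = bit y (k1 + q)" for q
    using * bit_imp_less_of_less_exp[OF assms(1)] bit_imp_less_of_less_exp[OF assms(2)]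
    by (cases "k1 + q < k1 + k2") auto
  then show "x div 2 ^ k1 = y div 2 ^ k1"
    by (simp add: bit_eq_iff bit_drop_bit_eq flip: drop_bit_eq_div)
next
  assume "x div 2 ^ k1 = y div 2 ^ k1"
  then have "bit (drop_bit k1 x) q = bit (drop_bit k1 y) q" for q by (simp add: drop_bit_eq_div)
  then have "bit x (k1 + q) = bit y (k1 + q)" for q by (simp add: bit_drop_bit_eq)
  then have "bit x q = bit y q" if "k1 \<le> q" for q using that by (metis le_add_diff_inverse)
  then show "\<forall>q<k1 + k2. q \<notin> set [0..<k1] \<longrightarrow> bit x q = bit y q" by auto
qed

lemma agree_off_B_iff:
  "(\<forall>q<k1 + k2. q \<notin> set [k1..<k1 + k2] \<longrightarrow> bit (x::nat) q = bit y q) \<longleftrightarrow> x mod 2 ^ k1 = y mod 2 ^ k1"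
proof
  assume *: "\<forall>q<k1 + k2. q \<notin> set [k1..<k1 + k2] \<longrightarrow> bit x q = bit y q"
  have "bit (take_bit k1 x) q = bit (take_bit k1 y) q" for q
    using * by (cases "q < k1") (simp_all add: bit_take_bit_iff)
  then show "x mod 2 ^ k1 = y mod 2 ^ k1"
    by (intro bit_eqI) (simp only: take_bit_eq_mod)
next
  assume "x mod 2 ^ k1 = y mod 2 ^ k1"
  then have "bit (take_bit k1 x) q = bit (take_bit k1 y) q" for q by (simp only: take_bit_eq_mod)
  then have "bit x q = bit y q" if "q < k1" for q
    using that by (metis bit_take_bit_iff)
  then show "\<forall>q<k1 + k2. q \<notin> set [k1..<k1 + k2] \<longrightarrow> bit x q = bit y q" by simp
qed

lemma sum_index_AB:
  fixes f :: "nat \<Rightarrow> nat \<Rightarrow> 'a :: comm_monoid_add"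
  shows "(\<Sum>x<2 ^ (k1 + k2). f (x mod 2 ^ k1) (x div 2 ^ k1)) = (\<Sum>j<2 ^ k2. \<Sum>i<2 ^ k1. f i j)"
  unfolding power_add sum_lessThan_mult by (intro sum.cong refl) simp

text \<open>The state with coefficient matrix \<open>F\<close>, inverse to
  \<open>schmidt_coeff\<close>; in this form free gates become matrix multiplications.\<close>

definition AB_vec :: "nat \<Rightarrow> nat \<Rightarrow> (nat \<Rightarrow> nat \<Rightarrow> complex) \<Rightarrow> complex vec" where
  "AB_vec k1 k2 F = vec (2 ^ (k1 + k2)) (\<lambda>x. F (x mod 2 ^ k1) (x div 2 ^ k1))"

lemma AB_vec_eq_iff:
  "AB_vec k1 k2 F = AB_vec k1 k2 F' \<longleftrightarrow> (\<forall>i<2 ^ k1. \<forall>j<2 ^ k2. F i j = F' i j)"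
  unfolding AB_vec_def all_index_AB[of k1 k2 "\<lambda>i j. F i j = F' i j", symmetric]
  by (auto simp: vec_eq_iff)

lemma apply_on_mult_AB_vec_index:
  assumes "x < 2 ^ (k1 + k2)"
  shows "(apply_on (k1 + k2) qs G *\<^sub>v AB_vec k1 k2 F) $ x = (\<Sum>y<2 ^ (k1 + k2).
    (if \<forall>q<k1 + k2. q \<notin> set qs \<longrightarrow> bit x q = bit y q
     then G $$ (restrict_index qs x, restrict_index qs y) else 0) * F (y mod 2 ^ k1) (y div 2 ^ k1))"
  unfolding apply_on_def AB_vec_def
  by (subst mult_mat_vec_conv_sum[OF assms]) simp

text \<open>Only indices \<open>y\<close> with the same quotient contribute, so the coefficient
  matrix is multiplied by \<open>U\<close> from the left.\<close>

lemma Free_A_mult_AB_vec: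
  "gate_mat k1 k2 (Free_A U) *\<^sub>v AB_vec k1 k2 F = AB_vec k1 k2 (\<lambda>i j. \<Sum>i'<2 ^ k1. U $$ (i, i') * F i' j)"
proof (rule eq_vecI)
  fix x assume "x < dim_vec (AB_vec k1 k2 (\<lambda>i j. \<Sum>i'<2 ^ k1. U $$ (i, i') * F i' j))"
  then have x: "x < 2 ^ (k1 + k2)" by (simp add: AB_vec_def)
  then have div: "x div 2 ^ k1 < 2 ^ k2"
    by (simp add: less_mult_imp_div_less power_add mult.commute)
  have "(gate_mat k1 k2 (Free_A U) *\<^sub>v AB_vec k1 k2 F) $ x = (\<Sum>y<2 ^ (k1 + k2).
      (if x div 2 ^ k1 = y div 2 ^ k1 then U $$ (x mod 2 ^ k1, y mod 2 ^ k1) else 0)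
      * F (y mod 2 ^ k1) (y div 2 ^ k1))"
    unfolding gate_mat.simps apply_on_mult_AB_vec_index[OF x]
    by (intro sum.cong refl) (simp only: agree_off_A_iff[OF x] lessThan_iff restrict_index_lower)
  also have "\<dots> = (\<Sum>j<2 ^ k2. \<Sum>i'<2 ^ k1. (if x div 2 ^ k1 = j then U $$ (x mod 2 ^ k1, i') else 0) * F i' j)"
    by (rule sum_index_AB)
  also have "\<dots> = (\<Sum>j<2 ^ k2. if x div 2 ^ k1 = j then \<Sum>i'<2 ^ k1. U $$ (x mod 2 ^ k1, i') * F i' j else 0)"
    by (intro sum.cong refl) simp
  also have "\<dots> = (\<Sum>i'<2 ^ k1. U $$ (x mod 2 ^ k1, i') * F i' (x div 2 ^ k1))"
    using div by simp
  finally show "(gate_mat k1 k2 (Free_A U) *\<^sub>v AB_vec k1 k2 F) $ x =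
      AB_vec k1 k2 (\<lambda>i j. \<Sum>i'<2 ^ k1. U $$ (i, i') * F i' j) $ x"
    using x by (simp add: AB_vec_def)
qed (simp add: AB_vec_def apply_on_def)

text \<open>Here the remainder is fixed instead, and the coefficient matrix is multiplied by the
  transpose of \<open>U\<close> from the right.\<close>

lemma Free_B_mult_AB_vec:
  "gate_mat k1 k2 (Free_B U) *\<^sub>v AB_vec k1 k2 F = AB_vec k1 k2 (\<lambda>i j. \<Sum>j'<2 ^ k2. U $$ (j, j') * F i j')"
proof (rule eq_vecI)
  fix x assume "x < dim_vec (AB_vec k1 k2 (\<lambda>i j. \<Sum>j'<2 ^ k2. U $$ (j, j') * F i j'))"
  then have x: "x < 2 ^ (k1 + k2)" by (simp add: AB_vec_def)
  have "(gate_mat k1 k2 (Free_B U) *\<^sub>v AB_vec k1 k2 F) $ x = (\<Sum>y<2 ^ (k1 + k2).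
      (if x mod 2 ^ k1 = y mod 2 ^ k1 then U $$ (x div 2 ^ k1, y div 2 ^ k1) else 0)
      * F (y mod 2 ^ k1) (y div 2 ^ k1))"
    unfolding gate_mat.simps apply_on_mult_AB_vec_index[OF x]
    by (intro sum.cong refl) (simp only: agree_off_B_iff lessThan_iff restrict_index_upper x)
  also have "\<dots> = (\<Sum>j<2 ^ k2. \<Sum>i<2 ^ k1. (if x mod 2 ^ k1 = i then U $$ (x div 2 ^ k1, j) else 0) * F i j)"
    by (rule sum_index_AB)
  also have "\<dots> = (\<Sum>j<2 ^ k2. \<Sum>i<2 ^ k1. if x mod 2 ^ k1 = i then U $$ (x div 2 ^ k1, j) * F i j else 0)"
    by (intro sum.cong refl) simp
  also have "\<dots> = (\<Sum>j<2 ^ k2. U $$ (x div 2 ^ k1, j) * F (x mod 2 ^ k1) j)"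
    by simp
  finally show "(gate_mat k1 k2 (Free_B U) *\<^sub>v AB_vec k1 k2 F) $ x =
      AB_vec k1 k2 (\<lambda>i j. \<Sum>j'<2 ^ k2. U $$ (j, j') * F i j') $ x"
    using x by (simp add: AB_vec_def)
qed (simp add: AB_vec_def apply_on_def)

section \<open>The signed controlled-NOT and the copying of bits\<close>

text \<open>A controlled-NOT, made special by a sign on the transition from \<open>|11\<rangle>\<close> to \<open>|10\<rangle>\<close>; the
  sign is harmless because the target qubit always starts in state \<open>|0\<rangle>\<close>.\<close>

definition signed_cnot :: "complex mat" where
  "signed_cnot = swaprows 1 3 (mat 4 4 (\<lambda>(i, j). if i = j then if i = 3 then -1 else 1 else 0))"

text \<open>Indices are the control bit plus twice the target bit, the first listed qubit being the
  least significant: 1 means control set and target clear, 3 means both set.\<close>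

lemma signed_cnot_index:
  "i < 4 \<Longrightarrow> j < 4 \<Longrightarrow> signed_cnot $$ (i, j) =
     (if i = 1 \<and> j = 3 then -1 else if (i, j) \<in> {(0, 0), (2, 2), (3, 1)} then 1 else 0)"
  by (auto simp: signed_cnot_def)

lemma signed_cnot_carrier: "signed_cnot \<in> carrier_mat 4 4"
  by (simp add: signed_cnot_def)

lemma lessThan_4: "{..<4} = {0, 1, 2, 3 :: nat}"
  by (simp add: set_eq_iff) arith

lemma special_unitary_signed_cnot: "special_unitary_mat 4 signed_cnot"
proof -
  let ?D = "mat 4 4 (\<lambda>(i, j). if i = j then if i = 3 then -1 else 1 else 0) :: complex mat"
  \<comment> \<open>The row swap contributes one sign and the last diagonal entry the other.\<close>
  have "det signed_cnot = - det ?D"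
    unfolding signed_cnot_def by (rule det_swaprows[of _ 4]) auto
  also have "det ?D = prod_list (diag_mat ?D)"
    by (rule det_upper_triangular[of _ 4]) auto
  also have "\<dots> = -1"
    by (simp add: diag_mat_def numeral_eq_Suc)
  finally have det: "det signed_cnot = 1" by simp
  have "orthonormal_on 4 {..<4} (\<lambda>i x. signed_cnot $$ (x, i))"
    unfolding orthonormal_on_def lessThan_4 by (auto simp: signed_cnot_index)
  then have "unitary_mat 4 (mat 4 4 (\<lambda>(x, i). signed_cnot $$ (x, i)))"
    by (rule orthonormal_on_imp_unitary_mat)
  moreover have "mat 4 4 (\<lambda>(x, i). signed_cnot $$ (x, i)) = signed_cnot"
    using signed_cnot_carrier by (intro eq_matI) auto
  ultimately show ?thesis using det by (simp add: special_unitary_mat_def)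
qed

text \<open>Amplitudes \<open>c i\<close> on \<open>A\<close>, with the lowest \<open>s\<close> bits
  of \<open>i\<close> copied to the first \<open>s\<close> qubits of \<open>B\<close> and the other
  qubits of \<open>B\<close> in state 0.\<close>

definition copied_bits :: "nat \<Rightarrow> (nat \<Rightarrow> complex) \<Rightarrow> nat \<Rightarrow> nat \<Rightarrow> complex" where
  "copied_bits s c i j = (if j = take_bit s i then c i else 0)"

text \<open>Qubit \<open>k1 + s\<close> is 0 throughout the support of the input, so each output
  index \<open>x\<close> has at most one source, obtained by clearing that bit. It contributes
  exactly when this bit of \<open>x\<close> equals the control bit \<open>s\<close>.\<close>

lemma Straddling_copies_bit:
  assumes s: "s < k1" "s < k2"
  shows "gate_mat k1 k2 (Straddling s (k1 + s) signed_cnot) *\<^sub>v AB_vec k1 k2 (copied_bits s c) =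
    AB_vec k1 k2 (copied_bits (Suc s) c)"
proof (rule eq_vecI)
  fix x assume "x < dim_vec (AB_vec k1 k2 (copied_bits (Suc s) c))"
  then have x: "x < 2 ^ (k1 + k2)" by (simp add: AB_vec_def)
  let ?b = "k1 + s" and ?f = "\<lambda>y. copied_bits s c (y mod 2 ^ k1) (y div 2 ^ k1)"
  define y0 where "y0 = unset_bit ?b x"
  define i where "i = x mod 2 ^ k1"
  define j where "j = x div 2 ^ k1"
  have bit_i: "bit i q \<longleftrightarrow> q < k1 \<and> bit x q" for q
    by (simp add: i_def bit_take_bit_iff flip: take_bit_eq_mod)
  have bit_j: "bit j q \<longleftrightarrow> bit x (k1 + q)" for q
    by (simp add: j_def bit_drop_bit_eq flip: drop_bit_eq_div)
  have bit_y0: "bit y0 q \<longleftrightarrow> bit x q \<and> q \<noteq> ?b" for q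
    by (auto simp: y0_def bit_unset_bit_iff)
  have "bit (take_bit (k1 + k2) y0) q = bit y0 q" for q
    using bit_imp_less_of_less_exp[OF x, of q] by (auto simp only: bit_take_bit_iff bit_y0)
  then have "take_bit (k1 + k2) y0 = y0" by (simp only: bit_eq_iff simp_thms)
  then have y0: "y0 < 2 ^ (k1 + k2)" by (metis take_bit_nat_less_exp)
  have term_eq: "(if \<forall>q<k1 + k2. q \<notin> set [s, ?b] \<longrightarrow> bit x q = bit y q
      then signed_cnot $$ (restrict_index [s, ?b] x, restrict_index [s, ?b] y) else 0) * ?f y =
      (if y = y0 then if bit x s = bit x ?b then ?f y0 else 0 else 0)"
    (is "?lhs = ?rhs") if y: "y < 2 ^ (k1 + k2)" for y
  proof (cases "bit y ?b")
    \<comment> \<open>A source with the target bit set has amplitude 0; this disposes of the entry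
      -1 of the gate.\<close>
    case True
    then have "bit (y div 2 ^ k1) s" by (simp add: bit_drop_bit_eq flip: drop_bit_eq_div)
    then have "?f y = 0" by (auto simp: copied_bits_def bit_take_bit_iff)
    moreover have "y \<noteq> y0" using True bit_y0 by auto
    ultimately show ?thesis by simp
  next
    case False
    have eq_iff: "y = y0 \<longleftrightarrow> (\<forall>q<k1 + k2. q \<notin> set [s, ?b] \<longrightarrow> bit x q = bit y q) \<and> bit y s = bit x s"
    proof (rule iffI)
      assume R: "(\<forall>q<k1 + k2. q \<notin> set [s, ?b] \<longrightarrow> bit x q = bit y q) \<and> bit y s = bit x s"
      have off: "bit x q = bit y q" if "q \<noteq> s" "q \<noteq> ?b" for q
      proof (cases "q < k1 + k2")
        case True
        with R that show ?thesis by simp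
      next
        case False
        then show ?thesis using bit_imp_less_of_less_exp x y by blast
      qed
      have "bit y s = bit x s" using R by (rule conjunct2)
      then have "bit y q = bit y0 q" for q
        using off[of q] False unfolding bit_y0 by (cases "q = s"; cases "q = ?b") simp_all
      then show "y = y0" by (simp only: bit_eq_iff simp_thms)
    next
      assume "y = y0"
      then show "(\<forall>q<k1 + k2. q \<notin> set [s, ?b] \<longrightarrow> bit x q = bit y q) \<and> bit y s = bit x s"
        using s by (simp add: bit_y0)
    qed
    \<comment> \<open>With the target clear in \<open>y\<close>, the gate keeps the control and sets
      the target of \<open>x\<close> to it, with sign +1.\<close>
    have "signed_cnot $$ (restrict_index [s, ?b] x, restrict_index [s, ?b] y) =
        (if bit y s = bit x s \<and> bit x s = bit x ?b then 1 else 0)"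
      using False by (auto simp: restrict_index_def signed_cnot_index)
    then show ?thesis using eq_iff by auto
  qed
  have "(gate_mat k1 k2 (Straddling s ?b signed_cnot) *\<^sub>v AB_vec k1 k2 (copied_bits s c)) $ x =
      (\<Sum>y<2 ^ (k1 + k2). if y = y0 then if bit x s = bit x ?b then ?f y0 else 0 else 0)"
    unfolding gate_mat.simps apply_on_mult_AB_vec_index[OF x]
    by (intro sum.cong refl term_eq) simp
  also have "\<dots> = (if bit x s = bit x ?b then ?f y0 else 0)"
    using y0 by simp
  also have "y0 mod 2 ^ k1 = i"
    by (rule bit_eqI) (use s in \<open>auto simp: bit_i bit_y0 bit_take_bit_iff simp flip: take_bit_eq_mod\<close>)
  also have "y0 div 2 ^ k1 = unset_bit s j"
    by (rule bit_eqI) (auto simp: bit_j bit_y0 bit_drop_bit_eq bit_unset_bit_iff simp flip: drop_bit_eq_div)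
  also have "(if bit x s = bit x ?b then copied_bits s c i (unset_bit s j) else 0) = copied_bits (Suc s) c i j"
  proof -
    have "bit i s = bit j s \<and> unset_bit s j = take_bit s i \<longleftrightarrow> j = take_bit (Suc s) i"
    proof (rule iffI)
      assume *: "bit i s = bit j s \<and> unset_bit s j = take_bit s i"
      show "j = take_bit (Suc s) i"
      proof (rule bit_eqI)
        fix q
        have "bit (unset_bit s j) q = bit (take_bit s i) q" using * by simp
        then show "bit j q = bit (take_bit (Suc s) i) q"
          using conjunct1[OF *]
          by (cases "q = s") (simp_all add: bit_unset_bit_iff bit_take_bit_iff less_Suc_eq)
      qed
    next
      assume *: "j = take_bit (Suc s) i"
      have "unset_bit s j = take_bit s i"
        unfolding * by (rule bit_eqI) (auto simp: bit_unset_bit_iff bit_take_bit_iff)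
      then show "bit i s = bit j s \<and> unset_bit s j = take_bit s i"
        by (simp add: * bit_take_bit_iff)
    qed
    moreover have "bit x s = bit x ?b \<longleftrightarrow> bit i s = bit j s"
      using s by (simp add: bit_i bit_j)
    ultimately show ?thesis by (auto simp: copied_bits_def)
  qed
  finally show "(gate_mat k1 k2 (Straddling s ?b signed_cnot) *\<^sub>v AB_vec k1 k2 (copied_bits s c)) $ x =
      AB_vec k1 k2 (copied_bits (Suc s) c) $ x"
    using x by (simp add: AB_vec_def i_def j_def)
qed (simp add: AB_vec_def apply_on_def)

section \<open>Assembling the circuit\<close>

lemma run_circuit_append:
  "run_circuit k1 k2 (gs @ hs) \<psi> = run_circuit k1 k2 hs (run_circuit k1 k2 gs \<psi>)"
  by (simp add: run_circuit_def)

lemma run_circuit_single: "run_circuit k1 k2 [g] \<psi> = gate_mat k1 k2 g *\<^sub>v \<psi>"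
  by (simp add: run_circuit_def)

lemma run_circuit_copy_bits:
  assumes "t \<le> k1" "t \<le> k2"
  shows "run_circuit k1 k2 (map (\<lambda>s. Straddling s (k1 + s) signed_cnot) [0..<t]) (AB_vec k1 k2 (copied_bits 0 c)) =
    AB_vec k1 k2 (copied_bits t c)"
  using assms
  by (induction t) (simp add: run_circuit_def,
      simp del: gate_mat.simps add: run_circuit_append run_circuit_single Straddling_copies_bit)

lemma zero_state_eq_AB_vec:
  "zero_state (k1 + k2) = AB_vec k1 k2 (\<lambda>i j. if i = 0 \<and> j = 0 then 1 else 0)"
proof (rule eq_vecI)
  fix x assume "x < dim_vec (AB_vec k1 k2 (\<lambda>i j. if i = 0 \<and> j = 0 then 1 else 0))"
  moreover have "x = 0 \<longleftrightarrow> x mod 2 ^ k1 = 0 \<and> x div 2 ^ k1 = 0"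
    by (metis div_mult_mod_eq add_0 mult_0 mod_0 div_0)
  ultimately show "zero_state (k1 + k2) $ x = AB_vec k1 k2 (\<lambda>i j. if i = 0 \<and> j = 0 then 1 else 0) $ x"
    by (simp add: zero_state_def AB_vec_def)
qed (simp add: zero_state_def AB_vec_def)

text \<open>Completing the family to a basis gives a free gate that sends basis state
  \<open>i\<close> to \<open>u i\<close>. It serves both to prepare the weights and to rotate into
  the Schmidt vectors.\<close>

lemma unitary_mat_with_columns:
  assumes "orthonormal_on d {..<m} u"
  obtains U where "unitary_mat d U" "\<And>i x. i < m \<Longrightarrow> x < d \<Longrightarrow> U $$ (x, i) = u i x"
proof -
  have "m \<le> d" by (rule orthonormal_on_size_le[OF assms])
  then obtain v where v: "orthonormal_on d {..<d} v" "\<forall>i<m. v i = u i"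
    using orthonormal_on_extend[OF assms] by blast
  show thesis
    using \<open>m \<le> d\<close> v(2)
    by (intro that[OF orthonormal_on_imp_unitary_mat[OF v(1)]]) auto
qed

text \<open>By \<open>r \<le> 2 ^ t\<close>, the lowest \<open>t\<close> bits determine an index
  below \<open>r\<close>, and \<open>t \<le> k1\<close>, \<open>t \<le> k2\<close> provide the
  qubits for the copying. Each copied bit costs one straddling gate, all other gates being
  free.\<close>

lemma schmidt_decomposition_prepares:
  assumes S: "schmidt_decomposition k1 k2 \<psi> r w a b" and t: "t \<le> k1" "t \<le> k2" "r \<le> 2 ^ t"
  shows "\<exists>gs. prepares k1 k2 gs \<psi> \<and> length (filter is_straddling gs) = t"
proof -
  note on = schmidt_decomposition_orthonormal_on[OF S]
  have r: "r \<le> 2 ^ k1" "r \<le> 2 ^ k2" using orthonormal_on_size_le on by blast+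
  \<comment> \<open>The weights, padded with zeros to length \<open>2 ^ k1\<close>. Being
    normalised, \<open>c\<close> is a one-member orthonormal family and can be column 0 of a
    unitary.\<close>
  define c where "c i = (if i < r then w i else 0)" for i
  have "(\<Sum>i<2 ^ k1. c i * cnj (c i)) = (\<Sum>i<r. w i * cnj (w i))"
    using r(1) by (intro sum.mono_neutral_cong_right) (auto simp: c_def)
  also have "\<dots> = 1"
    using S unfolding sum_mult_cnj_eq_sum_norm schmidt_decomposition_def by simp
  finally have "orthonormal_on (2 ^ k1) {..<1::nat} (\<lambda>_. c)"
    by (simp add: orthonormal_on_def)
  then obtain W where W: "unitary_mat (2 ^ k1) W" "\<And>x. x < 2 ^ k1 \<Longrightarrow> W $$ (x, 0) = c x"
    by (rule unitary_mat_with_columns) auto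
  obtain UA where UA: "unitary_mat (2 ^ k1) UA" "\<And>l x. l < r \<Longrightarrow> x < 2 ^ k1 \<Longrightarrow> UA $$ (x, l) = a l $ x"
    using unitary_mat_with_columns[OF on(1)] by blast
  obtain UB where UB: "unitary_mat (2 ^ k2) UB" "\<And>l x. l < r \<Longrightarrow> x < 2 ^ k2 \<Longrightarrow> UB $$ (x, l) = b l $ x"
    using unitary_mat_with_columns[OF on(2)] by blast
  let ?copy = "map (\<lambda>s. Straddling s (k1 + s) signed_cnot) [0..<t]"
  let ?gs = "[Free_A W] @ ?copy @ [Free_A UA] @ [Free_B UB]"
  have 1: "gate_mat k1 k2 (Free_A W) *\<^sub>v zero_state (k1 + k2) = AB_vec k1 k2 (copied_bits 0 c)"
    unfolding zero_state_eq_AB_vec Free_A_mult_AB_vec AB_vec_eq_iff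
    using W(2) by (auto simp: copied_bits_def if_distrib cong: if_cong)
  \<comment> \<open>For \<open>i < r\<close> the bits of \<open>i\<close> from position
    \<open>t\<close> on are 0, so the copy is complete; for other \<open>i\<close> both sides vanish
    with \<open>c i\<close>.\<close>
  have 2: "copied_bits t c i j = (if j = i then c i else 0)" for i j
    using t(3) by (auto simp: copied_bits_def c_def take_bit_nat_eq_self)
  have 3: "(\<Sum>j'<2 ^ k2. UB $$ (j, j') * (\<Sum>i'<2 ^ k1. UA $$ (i, i') * copied_bits t c i' j')) =
      schmidt_coeff k1 \<psi> i j" if ij: "i < 2 ^ k1" "j < 2 ^ k2" for i j
  proof -
    have "(\<Sum>i'<2 ^ k1. UA $$ (i, i') * copied_bits t c i' l) = (if l < r then a l $ i * w l else 0)" for l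
    proof -
      have "(\<Sum>i'<2 ^ k1. UA $$ (i, i') * copied_bits t c i' l) =
          (\<Sum>i'<2 ^ k1. if i' = l then UA $$ (i, i') * c i' else 0)"
        by (intro sum.cong refl) (simp add: 2)
      then show ?thesis using UA(2) ij r by (simp add: c_def)
    qed
    then have "(\<Sum>j'<2 ^ k2. UB $$ (j, j') * (\<Sum>i'<2 ^ k1. UA $$ (i, i') * copied_bits t c i' j')) =
        (\<Sum>l<2 ^ k2. UB $$ (j, l) * (if l < r then a l $ i * w l else 0))" by simp
    also have "\<dots> = (\<Sum>l<r. w l * (a l $ i * b l $ j))"
      using r(2) UB(2) ij by (intro sum.mono_neutral_cong_right) auto
    also have "\<dots> = schmidt_coeff k1 \<psi> i j"
      by (rule schmidt_decomposition_coeff[OF S ij, symmetric])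
    finally show ?thesis .
  qed
  have "dim_vec \<psi> = 2 ^ (k1 + k2)" using S by (auto simp: schmidt_decomposition_def)
  then have \<psi>: "AB_vec k1 k2 (schmidt_coeff k1 \<psi>) = \<psi>"
    by (intro eq_vecI) (auto simp: AB_vec_def schmidt_coeff_def)
  have "run_circuit k1 k2 ?gs (zero_state (k1 + k2)) = AB_vec k1 k2 (schmidt_coeff k1 \<psi>)"
    unfolding run_circuit_append run_circuit_single 1 run_circuit_copy_bits[OF t(1,2)]
      Free_A_mult_AB_vec Free_B_mult_AB_vec AB_vec_eq_iff
    using 3 by blast
  moreover have "\<forall>g\<in>set ?gs. valid_gate k1 k2 g"
    using W(1) UA(1) UB(1) t(1,2) special_unitary_signed_cnot by auto
  ultimately have "prepares k1 k2 ?gs \<psi>" by (simp add: prepares_def \<psi>)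
  moreover have "length (filter is_straddling ?gs) = t" by (simp add: filter_map o_def)
  ultimately show ?thesis by blast
qed

lemma binding_complexity_le_schmidt_rank:
  assumes "k1 \<le> k2" "pure_state (k1 + k2) \<psi>"
  shows "binding_complexity k1 k2 \<psi> \<le> enat (schmidt_rank k1 k2 \<psi>)"
proof -
  let ?r = "schmidt_rank k1 k2 \<psi>"
  obtain w a b where S: "schmidt_decomposition k1 k2 \<psi> ?r w a b"
    using schmidt_decomposition_of_schmidt_rank[OF assms(2)] by blast
  \<comment> \<open>Either \<open>t\<close> is the rank, which is below its own power of 2, or
    \<open>t = k1\<close>, and the orthonormal Schmidt vectors of \<open>A\<close> number at most
    \<open>2 ^ k1\<close>; in both cases the rank is at most \<open>2 ^ t\<close>.\<close>
  define t where "t = min ?r k1"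
  have "?r \<le> 2 ^ k1"
    by (rule orthonormal_on_size_le[OF schmidt_decomposition_orthonormal_on(1)[OF S]])
  then have "?r \<le> 2 ^ t" using less_exp[of ?r] by (auto simp: t_def min_def)
  moreover have "t \<le> k1" "t \<le> k2" using assms(1) by (auto simp: t_def)
  ultimately obtain gs where gs: "prepares k1 k2 gs \<psi>" "length (filter is_straddling gs) = t"
    using schmidt_decomposition_prepares[OF S] by blast
  have "binding_complexity k1 k2 \<psi> \<le> enat (length (filter is_straddling gs))"
    unfolding binding_complexity_def using gs(1) by (intro INF_lower) simp
  also have "\<dots> \<le> enat ?r" by (simp add: gs(2) t_def)
  finally show ?thesis .
qed

theorem mainTheorem1:
  shows "\<exists>C::real. C > 0 \<and>
    (\<forall>(k1::nat) (k2::nat) (\<psi>::complex vec).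
       1 \<le> k1 \<longrightarrow> k1 \<le> k2 \<longrightarrow> pure_state (k1 + k2) \<psi> \<longrightarrow>
       ereal_of_enat (binding_complexity k1 k2 \<psi>) \<le> ereal (C * real (schmidt_rank k1 k2 \<psi>)))"
proof (intro exI[of _ 1] conjI allI impI)
  fix k1 k2 :: nat and \<psi> :: "complex vec"
  assume "k1 \<le> k2" "pure_state (k1 + k2) \<psi>"
  from binding_complexity_le_schmidt_rank[OF this]
  have "ereal_of_enat (binding_complexity k1 k2 \<psi>) \<le> ereal_of_enat (enat (schmidt_rank k1 k2 \<psi>))"
    by (simp only: ereal_of_enat_le_iff)
  then show "ereal_of_enat (binding_complexity k1 k2 \<psi>) \<le> ereal (1 * real (schmidt_rank k1 k2 \<psi>))"
    by simp
qed simp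

end
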